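(* Let $n\ge1$ and let $\gamma^{(2n)}=\{\gamma_{ij}\}_{i,j\ge0,\,0\le i+j\le 2n}$ be a sequence of complex numbers. Suppose that $\gamma^{(2n)}$ has a representing measure and that for some integer $1\le k\le n$ there are scalars $a_{ij}\in\mathbb{C}$ $(0\le i+j<k)$ such that, in the column space of the moment matrix $M(n)(\gamma)$, $$Z^k=\sum_{0\le i+j<k}a_{ij}\bar Z^iZ^j .$$ Then $\gamma^{(2n)}$ has a unique representing measure, which is finitely atomic with at most $k^2$ atoms.
   Context: A representing measure for $\gamma^{(2n)}$ is a positive Borel measure $\mu$ on $\mathbb{C}$ such that $\gamma_{ij}=\int\bar z^iz^j\,d\mu(z)$ for $0\le i+j\le 2n$ (these monomials being absolutely integrable); uniqueness is among all such measures. The moment matrix $M(n)(\gamma)$ is the square matrix of size $(n+1)(n+2)/2$ whose rows and columns are labeled by $1,Z,\bar Z,Z^2,\bar ZZ,\bar Z^2,\dots,Z^n,\dots,\bar Z^n$ and whose entry in row $\bar Z^iZ^j$ and column $\bar Z^kZ^l$ ($i+j\le n$, $k+l\le n$) is $\gamma_{k+j,\,l+i}$. In the column relation, $\bar Z^iZ^j$ denotes the column of $M(n)(\gamma)$ with that label. *)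

theory Defs
  imports "HOL-Analysis.Analysis"
begin

text \<open>A truncated sequence is a total function \<open>\<gamma>\<close> of which only the values
  \<open>\<gamma> i j\<close> with \<open>i + j \<le> 2 * n\<close> are ever used. Integrability is required separately,
  since the Bochner integral of a non-integrable function is 0 by convention; the case
  \<open>i = j = 0\<close> makes the measure finite.\<close>

definition representing_measure ::
  "nat \<Rightarrow> (nat \<Rightarrow> nat \<Rightarrow> complex) \<Rightarrow> complex measure \<Rightarrow> bool" where
  "representing_measure n \<gamma> \<mu> \<longleftrightarrow>
     sets \<mu> = sets borel \<and>
     (\<forall>i j. i + j \<le> 2 * n \<longrightarrow>
        integrable \<mu> (\<lambda>z. cnj z ^ i * z ^ j) \<and>
        \<gamma> i j = (\<integral>z. cnj z ^ i * z ^ j \<partial>\<mu>))"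

text \<open>The pair \<open>(i, j)\<close> is the label of the monomial \<open>cnj Z ^ i * Z ^ j\<close>. Matrices and column
  vectors are functions on labels, extended by 0 outside the finitely many labels
  of degree at most \<open>n\<close>.\<close>

definition moment_labels :: "nat \<Rightarrow> (nat \<times> nat) set" where
  "moment_labels n = {(i, j). i + j \<le> n}"

definition moment_matrix ::
  "nat \<Rightarrow> (nat \<Rightarrow> nat \<Rightarrow> complex) \<Rightarrow> nat \<times> nat \<Rightarrow> nat \<times> nat \<Rightarrow> complex" where
  "moment_matrix n \<gamma> r c =
     (if r \<in> moment_labels n \<and> c \<in> moment_labels n
      then (case r of (i, j) \<Rightarrow> case c of (k, l) \<Rightarrow> \<gamma> (k + j) (l + i)) else 0)"

definition moment_column ::
  "nat \<Rightarrow> (nat \<Rightarrow> nat \<Rightarrow> complex) \<Rightarrow> nat \<times> nat \<Rightarrow> (nat \<times> nat \<Rightarrow> complex)" where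
  "moment_column n \<gamma> c = (\<lambda>r. moment_matrix n \<gamma> r c)"

text \<open>Finite positive combinations of point masses (the empty combination, i.e. the zero measure,
  included).\<close>

definition finitely_atomic :: "complex measure \<Rightarrow> bool" where
  "finitely_atomic \<mu> \<longleftrightarrow>
     sets \<mu> = sets borel \<and>
     (\<exists>S \<rho>. finite S \<and> (\<forall>z\<in>S. (\<rho> z :: real) > 0) \<and>
        (\<forall>A\<in>sets borel. emeasure \<mu> A = (\<Sum>z\<in>S. ennreal (\<rho> z) * indicator A z)))"

definition atoms :: "complex measure \<Rightarrow> complex set" where
  "atoms \<mu> = {z. emeasure \<mu> {z} > 0}"

end

(* The column relation says that P = z^k - q, with q of degree below k in z and cnj z, is
   orthogonal to all monomials of degree at most n in L2 of any representing measure, hence to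
   itself, so every representing measure lives on the zero set X of P. On X the relation for z^k
   and its conjugate for (cnj z)^k reduce every monomial to the k^2 monomials with both exponents
   below k. As every function on a finite subset of X is a polynomial in z, X has at most k^2
   points. The point masses are determined since indicators of points of X are combinations
   of monomials of degree at most 2k - 2. *)

theory Submission
  imports Defs "HOL-Library.Function_Algebras"
begin

section \<open>Functions on the zero set\<close>

interpretation cfun: vector_space "\<lambda>(c::complex) (f::'a \<Rightarrow> complex) z. c * f z"
  by unfold_locales (auto simp: fun_eq_iff algebra_simps)

definition zero_set :: "nat \<Rightarrow> (nat \<Rightarrow> nat \<Rightarrow> complex) \<Rightarrow> complex set" where
  "zero_set k a = {z. z ^ k = (\<Sum>(i, j)\<in>{(i, j). i + j < k}. a i j * (cnj z ^ i * z ^ j))}"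

text \<open>Truncating to \<open>X\<close> turns identities that hold only on \<open>X\<close> into
  equalities of functions, so that the relation for \<open>z ^ k\<close> can be used inside a
  span.\<close>

definition monomial_on :: "complex set \<Rightarrow> nat \<Rightarrow> nat \<Rightarrow> complex \<Rightarrow> complex" where
  "monomial_on X i j = (\<lambda>z. if z \<in> X then cnj z ^ i * z ^ j else 0)"

definition box_monomials :: "complex set \<Rightarrow> nat \<Rightarrow> (complex \<Rightarrow> complex) set" where
  "box_monomials X k = (\<lambda>(i, j). monomial_on X i j) ` ({..<k} \<times> {..<k})"

lemma sum_fun_apply: "(\<Sum>i\<in>I. f i) z = (\<Sum>i\<in>I. f i z)" for f :: "'i \<Rightarrow> 'a \<Rightarrow> complex"
  by (induction I rule: infinite_finite_induct) auto

lemma finite_box_monomials: "finite (box_monomials X k)"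
  by (simp add: box_monomials_def)

lemma card_box_monomials: "card (box_monomials X k) \<le> k ^ 2"
  unfolding box_monomials_def
  by (rule order_trans[OF card_image_le]) (auto simp: power2_eq_square)

text \<open>Induction on total degree: the right-hand side of the relation has degree below
  \<open>k\<close>, so substituting it for a factor \<open>z ^ k\<close>, or its conjugate for
  \<open>cnj z ^ k\<close>, strictly lowers the degree. Subsets of the zero set are allowed because
  the counting argument works with finite subsets before the zero set is known to be finite.\<close>

lemma monomial_on_in_span:
  assumes X: "X \<subseteq> zero_set k a"
  shows "monomial_on X i j \<in> cfun.span (box_monomials X k)"
proof (induction "i + j" arbitrary: i j rule: less_induct)
  case less
  let ?L = "{(i, j). i + j < k}"
  consider "i < k" "j < k" | "j \<ge> k" | "i \<ge> k" by linarith
  then show ?case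
  proof cases
    case 1
    then show ?thesis
      by (intro cfun.span_base) (auto simp: box_monomials_def)
  next
    case 2
    have "monomial_on X i j =
        (\<Sum>(i', j')\<in>?L. (\<lambda>z. a i' j' * monomial_on X (i + i') (j - k + j') z))"
    proof
      fix z
      show "monomial_on X i j z =
          (\<Sum>(i', j')\<in>?L. (\<lambda>z. a i' j' * monomial_on X (i + i') (j - k + j') z)) z"
      proof (cases "z \<in> X")
        case True
        have "monomial_on X i j z = cnj z ^ i * z ^ (j - k) * z ^ k"
          using True 2 by (simp add: monomial_on_def mult.assoc flip: power_add)
        also have "z ^ k = (\<Sum>(i, j)\<in>?L. a i j * (cnj z ^ i * z ^ j))"
          using True X by (auto simp: zero_set_def)
        finally show ?thesis using True
          by (simp add: sum_fun_apply sum_distrib_left case_prod_unfold monomial_on_def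
              power_add mult_ac)
      qed (simp add: monomial_on_def sum_fun_apply case_prod_unfold)
    qed
    also have "\<dots> \<in> cfun.span (box_monomials X k)"
      using 2 by (intro cfun.span_sum) (auto intro!: cfun.span_scale less)
    finally show ?thesis .
  next
    case 3
    \<comment> \<open>Conjugating the relation swaps the two exponents, so \<open>j'\<close> now
      joins the power of \<open>cnj z\<close> and \<open>i'\<close> the power of
      \<open>z\<close>.\<close>
    have "monomial_on X i j =
        (\<Sum>(i', j')\<in>?L. (\<lambda>z. cnj (a i' j') * monomial_on X (i - k + j') (j + i') z))"
    proof
      fix z
      show "monomial_on X i j z =
          (\<Sum>(i', j')\<in>?L. (\<lambda>z. cnj (a i' j') * monomial_on X (i - k + j') (j + i') z)) z"
      proof (cases "z \<in> X")
        case True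
        have "monomial_on X i j z = cnj z ^ (i - k) * z ^ j * cnj (z ^ k)"
          using True 3 by (simp add: monomial_on_def mult_ac flip: power_add)
        also have "z ^ k = (\<Sum>(i, j)\<in>?L. a i j * (cnj z ^ i * z ^ j))"
          using True X by (auto simp: zero_set_def)
        finally show ?thesis using True
          by (simp add: sum_fun_apply sum_distrib_left case_prod_unfold monomial_on_def
              power_add mult_ac)
      qed (simp add: monomial_on_def sum_fun_apply case_prod_unfold)
    qed
    also have "\<dots> \<in> cfun.span (box_monomials X k)"
      using 3 by (intro cfun.span_sum) (auto intro!: cfun.span_scale less)
    finally show ?thesis .
  qed
qed

text \<open>Lagrange interpolation: the polynomial vanishing on \<open>X - {w}\<close>, divided by
  its nonzero value at \<open>w\<close>, agrees with the indicator on \<open>X\<close>. It involves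
  only powers of \<open>z\<close>, whose degrees may exceed \<open>k\<close> but are reduced by
  \<open>monomial_on_in_span\<close>.\<close>

lemma indicator_in_span:
  assumes X: "X \<subseteq> zero_set k a" and fin: "finite X" and w: "w \<in> X"
  shows "indicator {w} \<in> cfun.span (box_monomials X k)"
proof -
  define p where "p = (\<Prod>s\<in>X - {w}. [:- s, 1:])"
  have p: "poly p z = (\<Prod>s\<in>X - {w}. z - s)" for z
    by (simp add: p_def poly_prod)
  have "indicator {w} =
      (\<Sum>i\<le>degree p. (\<lambda>z. (coeff p i / poly p w) * monomial_on X 0 i z))"
  proof
    fix z
    have "indicator {w} z = (if z \<in> X then poly p z / poly p w else 0)"
      using fin w by (auto simp: p indicator_def)
    also have "\<dots> = (\<Sum>i\<le>degree p. (\<lambda>z. (coeff p i / poly p w) * monomial_on X 0 i z)) z"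
      by (simp add: sum_fun_apply monomial_on_def poly_altdef sum_divide_distrib)
    finally show "indicator {w} z =
        (\<Sum>i\<le>degree p. (\<lambda>z. (coeff p i / poly p w) * monomial_on X 0 i z)) z" .
  qed
  also have "\<dots> \<in> cfun.span (box_monomials X k)"
    by (intro cfun.span_sum cfun.span_scale monomial_on_in_span[OF X])
  finally show ?thesis .
qed

section \<open>Independence of point indicators and the size of the zero set\<close>

lemma inj_indicator_singleton: "inj (\<lambda>w. indicator {w} :: 'a \<Rightarrow> complex)"
  by (rule injI) (metis indicator_simps singletonD singletonI zero_neq_one)

lemma independent_indicators:
  assumes "finite S"
  shows "\<not> cfun.dependent ((\<lambda>w. indicator {w} :: 'a \<Rightarrow> complex) ` S)"
proof -
  have "u (indicator {w}) = 0"
    if w: "w \<in> S" and eq: "(\<Sum>v\<in>(\<lambda>w. indicator {w}) ` S. (\<lambda>z. u v * v z)) = 0"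
    for u :: "('a \<Rightarrow> complex) \<Rightarrow> complex" and w
  proof -
    \<comment> \<open>Evaluating the vanishing combination at \<open>w\<close> isolates the
      coefficient of \<open>indicator {w}\<close>.\<close>
    have "0 = (\<Sum>v\<in>(\<lambda>w. indicator {w}) ` S. (\<lambda>z. u v * v z)) w"
      by (simp add: eq)
    also have "\<dots> = (\<Sum>s\<in>S. u (indicator {s}) * indicator {s} w)"
      by (simp add: sum_fun_apply sum.reindex[OF inj_on_subset[OF inj_indicator_singleton]])
    also have "\<dots> = (\<Sum>s\<in>S. if s = w then u (indicator {w}) else 0)"
      by (intro sum.cong) auto
    also have "\<dots> = u (indicator {w})"
      using w assms by simp
    finally show ?thesis by simp
  qed
  then show ?thesis
    using assms by (auto simp: cfun.dependent_finite)
qed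

text \<open>The indicators of the points of \<open>S\<close> are independent and lie in the span of
  at most \<open>k ^ 2\<close> functions. Truncating to \<open>S\<close> itself is what makes
  interpolation over a finite set available.\<close>

lemma card_subset_zero_set:
  assumes "S \<subseteq> zero_set k a" "finite S"
  shows "card S \<le> k ^ 2"
proof -
  have "card ((\<lambda>w. indicator {w} :: complex \<Rightarrow> complex) ` S) \<le> card (box_monomials S k)"
    using cfun.independent_span_bound[OF finite_box_monomials independent_indicators]
      indicator_in_span[OF assms] assms(2) by blast
  then show ?thesis
    using card_box_monomials[of S k]
    by (simp add: card_image[OF inj_on_subset[OF inj_indicator_singleton]])
qed

lemma finite_zero_set: "finite (zero_set k a)"
  using finite_if_finite_subsets_card_bdd[of "zero_set k a" "k ^ 2"] card_subset_zero_set
  by metis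

section \<open>Measures on the zero set\<close>

lemma zero_set_borel: "zero_set k a \<in> sets borel"
  by (simp add: finite_zero_set finite_imp_closed)

lemma representing_measure_AE:
  assumes \<mu>: "representing_measure n \<gamma> \<mu>" and k: "k \<le> n"
    and rel: "moment_column n \<gamma> (0, k) =
           (\<lambda>r. \<Sum>(i, j)\<in>{(i, j). i + j < k}. a i j * moment_column n \<gamma> (i, j) r)"
  shows "AE z in \<mu>. z \<in> zero_set k a"
proof -
  let ?L = "{(i, j). i + j < k}"
  define P where
    "P = (\<lambda>z. z ^ k - (\<Sum>(i, j)\<in>?L. a i j * (cnj z ^ i * z ^ j)))"
  have int: "integrable \<mu> (\<lambda>z. cnj z ^ i * z ^ j)"
    and \<gamma>: "\<gamma> i j = (\<integral>z. cnj z ^ i * z ^ j \<partial>\<mu>)" if "i + j \<le> 2 * n" for i j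
    using \<mu> that by (auto simp: representing_measure_def)
  have expand: "cnj z ^ j * z ^ i * P z = cnj z ^ j * z ^ (k + i)
      - (\<Sum>(i', j')\<in>?L. a i' j' * (cnj z ^ (i' + j) * z ^ (j' + i)))" for z i j
    by (simp add: P_def right_diff_distrib sum_distrib_left case_prod_unfold power_add mult_ac)
  \<comment> \<open>The entry of the moment matrix in row \<open>(i, j)\<close> integrates the
    monomial of the column against the conjugate of the monomial of the row, which explains the
    swapped exponents. All degrees involved are at most \<open>n + k\<close>, hence within the range
    of the moments.\<close>
  have orth: "integrable \<mu> (\<lambda>z. cnj z ^ j * z ^ i * P z)
      \<and> (\<integral>z. cnj z ^ j * z ^ i * P z \<partial>\<mu>) = 0" if ij: "i + j \<le> n" for i j
  proof -
    have int1: "integrable \<mu> (\<lambda>z. cnj z ^ j * z ^ (k + i))"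
      using ij k by (intro int) auto
    have int2: "integrable \<mu> (\<lambda>z. case x of (i', j') \<Rightarrow>
        a i' j' * (cnj z ^ (i' + j) * z ^ (j' + i)))" if "x \<in> ?L" for x
      using that ij k by (auto intro!: int integrable_mult_right)
    have "\<gamma> j (k + i) = moment_column n \<gamma> (0, k) (i, j)"
      using ij k by (simp add: moment_column_def moment_matrix_def moment_labels_def)
    also have "\<dots> = (\<Sum>(i', j')\<in>?L. a i' j' * moment_column n \<gamma> (i', j') (i, j))"
      by (simp add: rel)
    also have "\<dots> = (\<Sum>(i', j')\<in>?L. a i' j' * \<gamma> (i' + j) (j' + i))"
      using ij k
      by (intro sum.cong) (auto simp: moment_column_def moment_matrix_def moment_labels_def)
    also have "\<dots> = (\<Sum>x\<in>?L. \<integral>z. (case x of (i', j') \<Rightarrow>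
        a i' j' * (cnj z ^ (i' + j) * z ^ (j' + i))) \<partial>\<mu>)"
      using ij k by (intro sum.cong) (auto simp: \<gamma>)
    also have "\<dots> = (\<integral>z. (\<Sum>(i', j')\<in>?L.
        a i' j' * (cnj z ^ (i' + j) * z ^ (j' + i))) \<partial>\<mu>)"
      by (rule Bochner_Integration.integral_sum[symmetric]) (rule int2)
    finally have eq: "(\<integral>z. cnj z ^ j * z ^ (k + i) \<partial>\<mu>) = (\<integral>z. (\<Sum>(i', j')\<in>?L.
        a i' j' * (cnj z ^ (i' + j) * z ^ (j' + i))) \<partial>\<mu>)"
      using \<gamma>[of j "k + i"] ij k by simp
    have int3: "integrable \<mu> (\<lambda>z. \<Sum>(i', j')\<in>?L.
        a i' j' * (cnj z ^ (i' + j) * z ^ (j' + i)))"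
      by (rule Bochner_Integration.integrable_sum) (rule int2)
    show ?thesis
      unfolding expand using int1 int3 eq by simp
  qed
  \<comment> \<open>Only the conjugate factor of \<open>cnj (P z) * P z\<close> is expanded, so that
    every term is an instance of \<open>orth\<close>; the factor \<open>z ^ 0\<close> gives the
    leading term that shape too.\<close>
  have norm_P: "complex_of_real ((cmod (P z))\<^sup>2) = cnj z ^ k * z ^ 0 * P z
      - (\<Sum>(i, j)\<in>?L. cnj (a i j) * (cnj z ^ j * z ^ i * P z))" for z
  proof -
    have "complex_of_real ((cmod (P z))\<^sup>2) = cnj (P z) * P z"
      by (simp only: complex_norm_square mult.commute)
    also have "cnj (P z) = cnj z ^ k - (\<Sum>(i, j)\<in>?L. cnj (a i j) * (cnj z ^ j * z ^ i))"
      by (simp add: P_def case_prod_unfold mult_ac)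
    finally show ?thesis
      by (simp add: left_diff_distrib sum_distrib_right case_prod_unfold mult.assoc)
  qed
  have int4: "integrable \<mu> (\<lambda>z. case x of (i, j) \<Rightarrow>
      cnj (a i j) * (cnj z ^ j * z ^ i * P z))" if "x \<in> ?L" for x
    using that k orth by auto
  have int5: "integrable \<mu> (\<lambda>z. \<Sum>(i, j)\<in>?L. cnj (a i j) * (cnj z ^ j * z ^ i * P z))"
    by (rule Bochner_Integration.integrable_sum) (rule int4)
  have int6: "integrable \<mu> (\<lambda>z. cnj z ^ k * z ^ 0 * P z)"
    and zero6: "(\<integral>z. cnj z ^ k * z ^ 0 * P z \<partial>\<mu>) = 0"
    using orth[of 0 k] k by auto
  have "(\<integral>z. (\<Sum>(i, j)\<in>?L. cnj (a i j) * (cnj z ^ j * z ^ i * P z)) \<partial>\<mu>) =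
      (\<Sum>x\<in>?L. \<integral>z. (case x of (i, j) \<Rightarrow> cnj (a i j) * (cnj z ^ j * z ^ i * P z)) \<partial>\<mu>)"
    by (rule Bochner_Integration.integral_sum) (rule int4)
  also have "\<dots> = 0"
    using k orth by (intro sum.neutral) auto
  finally have "(\<integral>z. complex_of_real ((cmod (P z))\<^sup>2) \<partial>\<mu>) = 0"
    unfolding norm_P using int5 int6 zero6 by simp
  then have zero: "(\<integral>z. (cmod (P z))\<^sup>2 \<partial>\<mu>) = 0"
    by (simp del: of_real_power)
  \<comment> \<open>A zero integral forces a nonnegative function to vanish almost everywhere only
    if it is integrable, since other integrals default to 0.\<close>
  have "integrable \<mu> (\<lambda>z. complex_of_real ((cmod (P z))\<^sup>2))"
    unfolding norm_P using int5 int6 by (rule Bochner_Integration.integrable_diff[rotated])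
  then have "integrable \<mu> (\<lambda>z. (cmod (P z))\<^sup>2)"
    by (simp del: of_real_power add: complex_of_real_integrable_eq)
  then have "AE z in \<mu>. (cmod (P z))\<^sup>2 = 0"
    using zero by (subst (asm) integral_nonneg_eq_0_iff_AE) auto
  then show ?thesis
    by eventually_elim (auto simp: P_def zero_set_def)
qed

section \<open>Point masses and uniqueness\<close>

lemma emeasure_eq_sum_points:
  fixes \<mu> :: "complex measure"
  assumes sets: "sets \<mu> = sets borel" and X: "finite X" and AE: "AE z in \<mu>. z \<in> X"
    and A: "A \<in> sets borel"
  shows "emeasure \<mu> A = (\<Sum>z\<in>X. emeasure \<mu> {z} * indicator A z)"
proof -
  have pts: "{z} \<in> sets \<mu>" for z
    by (simp add: sets)
  have "emeasure \<mu> A = emeasure \<mu> (A \<inter> X)"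
    using AE X A by (intro emeasure_eq_AE) (auto simp: sets finite_imp_closed)
  also have "\<dots> = (\<Sum>z\<in>A \<inter> X. emeasure \<mu> {z})"
    using X pts by (intro emeasure_eq_sum_singleton) auto
  also have "\<dots> = (\<Sum>z\<in>X. emeasure \<mu> {z} * indicator A z)"
    using X by (intro sum.mono_neutral_cong_left) (auto simp: indicator_def)
  finally show ?thesis .
qed

lemma representing_measure_finite:
  assumes "representing_measure n \<gamma> \<mu>"
  shows "finite_measure \<mu>"
proof -
  have "\<forall>i j. i + j \<le> 2 * n \<longrightarrow> integrable \<mu> (\<lambda>z. cnj z ^ i * z ^ j)"
    using assms by (simp add: representing_measure_def)
  \<comment> \<open>With both exponents 0 the monomial is the constant 1.\<close>
  from this[rule_format, of 0 0] show ?thesis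
    by (intro finite_measureI) (simp add: integrable_iff_bounded less_top)
qed

text \<open>Each box monomial has degree at most \<open>2 * k - 2\<close>, so its integral is a
  prescribed moment; truncation to \<open>X\<close> changes it only on a null set. Linearity does
  the rest.\<close>

lemma integral_span_eq:
  assumes \<mu>: "representing_measure n \<gamma> \<mu>" "AE z in \<mu>. z \<in> X"
    and \<nu>: "representing_measure n \<gamma> \<nu>" "AE z in \<nu>. z \<in> X"
    and X: "X \<in> sets borel" and k: "k \<le> n"
    and f: "f \<in> cfun.span (box_monomials X k)"
  shows "integrable \<mu> f \<and> integrable \<nu> f \<and> (\<integral>z. f z \<partial>\<mu>) = (\<integral>z. f z \<partial>\<nu>)"
  using f
proof (induction rule: cfun.span_induct_alt)
  case base
  show ?case by (simp add: zero_fun_def)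
next
  case (step c x y)
  then obtain i j where x: "x = monomial_on X i j" and ij: "i + j \<le> 2 * n"
    using k by (auto simp: box_monomials_def)
  have *: "integrable M x \<and> (\<integral>z. x z \<partial>M) = \<gamma> i j"
    if M: "representing_measure n \<gamma> M" and AE: "AE z in M. z \<in> X" for M
  proof -
    have sets [measurable_cong]: "sets M = sets borel"
      and int: "integrable M (\<lambda>z. cnj z ^ i * z ^ j)"
      and \<gamma>: "\<gamma> i j = (\<integral>z. cnj z ^ i * z ^ j \<partial>M)"
      using M ij by (auto simp: representing_measure_def)
    note [measurable] = X borel_measurable_integrable[OF int]
    have meas: "x \<in> borel_measurable M"
      unfolding x monomial_on_def by measurable
    have ae: "AE z in M. cnj z ^ i * z ^ j = x z"
      using AE by eventually_elim (simp add: x monomial_on_def)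
    show ?thesis
      using integrable_cong_AE_imp[OF int meas ae] integral_cong_AE[OF _ meas ae]
        borel_measurable_integrable[OF int] \<gamma> by auto
  qed
  show ?case
    using *[OF \<mu>] *[OF \<nu>] step(2) by (auto simp: plus_fun_def)
qed

text \<open>The zero set depends only on \<open>k\<close> and \<open>a\<close>, so both measures
  live on the same finite set and are determined by their point masses. These are integrals of
  indicators in the span of the box monomials.\<close>

lemma representing_measure_unique:
  assumes \<mu>: "representing_measure n \<gamma> \<mu>" and \<nu>: "representing_measure n \<gamma> \<nu>" and k: "k \<le> n"
    and rel: "moment_column n \<gamma> (0, k) =
           (\<lambda>r. \<Sum>(i, j)\<in>{(i, j). i + j < k}. a i j * moment_column n \<gamma> (i, j) r)"
  shows "\<nu> = \<mu>"
proof -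
  let ?X = "zero_set k a"
  have sets: "sets \<mu> = sets borel" "sets \<nu> = sets borel"
    using \<mu> \<nu> by (auto simp: representing_measure_def)
  note AE = representing_measure_AE[OF \<mu> k rel] representing_measure_AE[OF \<nu> k rel]
  have pt: "emeasure \<nu> {w} = emeasure \<mu> {w}" if w: "w \<in> ?X" for w
  proof -
    have "(\<integral>z. (indicator {w} z :: complex) \<partial>\<mu>) = (\<integral>z. indicator {w} z \<partial>\<nu>)"
      using integral_span_eq[OF \<mu> AE(1) \<nu> AE(2) zero_set_borel k
          indicator_in_span[OF order_refl finite_zero_set w]] by blast
    moreover have "(\<integral>z. (indicator {w} z :: complex) \<partial>M) = measure M {w}"
      if "representing_measure n \<gamma> M" for M
    proof -
      interpret finite_measure M by (rule representing_measure_finite[OF that])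
      have "sets M = sets borel"
        using that by (simp add: representing_measure_def)
      then have "{w} \<in> sets M" by simp
      then have "(\<integral>z. complex_of_real (indicator {w} z) \<partial>M) = measure M {w}"
        by (subst integral_complex_of_real) (simp add: sets.Int_space_eq2)
      then show ?thesis by (simp add: of_real_indicator)
    qed
    ultimately have "measure \<mu> {w} = measure \<nu> {w}"
      using \<mu> \<nu> by simp
    then show ?thesis
      using representing_measure_finite[OF \<mu>] representing_measure_finite[OF \<nu>]
      by (simp add: finite_measure.emeasure_eq_measure)
  qed
  show ?thesis
  proof (rule measure_eqI)
    show "sets \<nu> = sets \<mu>" by (simp add: sets)
    fix A assume "A \<in> sets \<nu>"
    then have A: "A \<in> sets borel" by (simp add: sets)
    show "emeasure \<nu> A = emeasure \<mu> A"
      by (simp add: emeasure_eq_sum_points[OF sets(1) finite_zero_set AE(1) A]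
          emeasure_eq_sum_points[OF sets(2) finite_zero_set AE(2) A] pt)
  qed
qed

section \<open>Atoms of the representing measure\<close>

lemma finitely_atomicI:
  assumes "finite_measure \<mu>" and sets: "sets \<mu> = sets borel"
    and X: "finite X" and AE: "AE z in \<mu>. z \<in> X"
  shows "finitely_atomic \<mu>"
proof -
  interpret finite_measure \<mu> by fact
  \<comment> \<open>\<open>finitely_atomic\<close> demands strictly positive weights, so null points
    of \<open>X\<close> are discarded.\<close>
  let ?S = "{z \<in> X. measure \<mu> {z} > 0}"
  have "emeasure \<mu> A = (\<Sum>z\<in>?S. ennreal (measure \<mu> {z}) * indicator A z)"
    if "A \<in> sets borel" for A
  proof -
    have "emeasure \<mu> A = (\<Sum>z\<in>X. ennreal (measure \<mu> {z}) * indicator A z)"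
      by (simp add: emeasure_eq_sum_points[OF sets X AE that] flip: emeasure_eq_measure)
    also have "\<dots> = (\<Sum>z\<in>?S. ennreal (measure \<mu> {z}) * indicator A z)"
      using X by (intro sum.mono_neutral_right) (auto simp: zero_less_measure_iff)
    finally show ?thesis .
  qed
  then show ?thesis
    unfolding finitely_atomic_def using sets X
    by (intro conjI exI[of _ ?S] exI[of _ "\<lambda>z. measure \<mu> {z}"]) auto
qed

lemma atoms_subset:
  assumes sets: "sets \<mu> = sets borel" and X: "finite X" and AE: "AE z in \<mu>. z \<in> X"
  shows "atoms \<mu> \<subseteq> X"
proof
  fix w assume "w \<in> atoms \<mu>"
  then have "0 < emeasure \<mu> {w}" by (simp add: atoms_def)
  also have "emeasure \<mu> {w} = (\<Sum>z\<in>X. emeasure \<mu> {z} * indicator {w} z)"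
    by (rule emeasure_eq_sum_points[OF sets X AE]) simp
  finally show "w \<in> X"
    by (rule contrapos_pp) (auto simp: indicator_def intro!: sum.neutral)
qed

theorem proposition4p2:
  fixes n k :: nat and \<gamma> a :: "nat \<Rightarrow> nat \<Rightarrow> complex"
  assumes "n \<ge> 1"
    and "\<exists>\<mu>. representing_measure n \<gamma> \<mu>"
    and "1 \<le> k" and "k \<le> n"
    and "moment_column n \<gamma> (0, k) =
           (\<lambda>r. \<Sum>(i, j)\<in>{(i, j). i + j < k}. a i j * moment_column n \<gamma> (i, j) r)"
  shows "\<exists>\<mu>. representing_measure n \<gamma> \<mu> \<and>
             (\<forall>\<nu>. representing_measure n \<gamma> \<nu> \<longrightarrow> \<nu> = \<mu>) \<and>
             finitely_atomic \<mu> \<and> card (atoms \<mu>) \<le> k ^ 2"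
proof -
  obtain \<mu> where \<mu>: "representing_measure n \<gamma> \<mu>"
    using assms(2) by blast
  then have sets: "sets \<mu> = sets borel"
    by (simp add: representing_measure_def)
  note AE = representing_measure_AE[OF \<mu> assms(4,5)]
  \<comment> \<open>The atoms form a subset of the finite zero set, so the bound does not come from
    the value 0 of \<open>card\<close> on infinite sets.\<close>
  have "card (atoms \<mu>) \<le> k ^ 2"
    using atoms_subset[OF sets finite_zero_set AE] finite_zero_set
    by (intro card_subset_zero_set) (auto intro: finite_subset)
  then show ?thesis
    using \<mu> representing_measure_unique[OF \<mu> _ assms(4,5)]
      finitely_atomicI[OF representing_measure_finite[OF \<mu>] sets finite_zero_set AE] by blast
qed

end
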